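(* Let $\mathbf A$ be a finite subdirectly irreducible algebra. If $\mathbf A$ is weakly projective in $\mathbf Q(\mathbf A)$, then $\mathbf A$ is projective in $\mathbf Q(\mathbf A)$.
   Context: $\mathbf Q(\mathbf A)=\mathbf{ISPP}_u(\mathbf A)$ is the quasivariety generated by $\mathbf A$. For a class $\mathsf K$ of algebras of the same type as $\mathbf A$: $\mathbf A$ is weakly projective in $\mathsf K$ (weakly $\mathsf K$-projective) if for all $\mathbf B\in\mathsf K$, whenever $\mathbf A$ is a homomorphic image of $\mathbf B$, $\mathbf A$ is isomorphic to a subalgebra of $\mathbf B$; $\mathbf A$ is projective in $\mathsf K$ if for every $\mathbf B\in\mathsf K$ and every surjective homomorphism $f:\mathbf B\to\mathbf A$ there is an embedding $g:\mathbf A\to\mathbf B$ with $f(g(a))=a$ for all $a\in A$. *)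

theory Defs
  imports "HOL-Library.FuncSet"
begin

section \<open>Algebras and homomorphisms\<close>

text \<open>The operation symbols of a similarity type \<open>\<sigma>\<close> are the elements of \<open>dom \<sigma>\<close>, and
  \<open>\<sigma> f = Some n\<close> means that \<open>f\<close> has arity \<open>n\<close>; there may be no operation symbols, infinitely
  many, or some of arity \<open>0\<close>. The value of \<open>interp A f xs\<close> is meaningful only if \<open>xs\<close> is a
  list of elements of the universe whose length is the arity of \<open>f\<close>.\<close>

type_synonym 'f simtype = "'f \<rightharpoonup> nat"

record ('f, 'a) alg =
  univ :: "'a set"
  interp :: "'f \<Rightarrow> 'a list \<Rightarrow> 'a"

definition args :: "'f simtype \<Rightarrow> ('f, 'a) alg \<Rightarrow> ('f \<times> 'a list) set" where
  "args \<sigma> A = {(f, xs). \<sigma> f = Some (length xs) \<and> set xs \<subseteq> univ A}"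

definition algebra :: "'f simtype \<Rightarrow> ('f, 'a) alg \<Rightarrow> bool" where
  "algebra \<sigma> A \<longleftrightarrow> univ A \<noteq> {} \<and> (\<forall>(f, xs)\<in>args \<sigma> A. interp A f xs \<in> univ A)"

definition homom :: "'f simtype \<Rightarrow> ('f, 'a) alg \<Rightarrow> ('f, 'b) alg \<Rightarrow> ('a \<Rightarrow> 'b) \<Rightarrow> bool" where
  "homom \<sigma> A B h \<longleftrightarrow> h \<in> univ A \<rightarrow> univ B \<and>
     (\<forall>(f, xs)\<in>args \<sigma> A. h (interp A f xs) = interp B f (map h xs))"

definition surj_homom :: "'f simtype \<Rightarrow> ('f, 'a) alg \<Rightarrow> ('f, 'b) alg \<Rightarrow> ('a \<Rightarrow> 'b) \<Rightarrow> bool" where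
  "surj_homom \<sigma> A B h \<longleftrightarrow> homom \<sigma> A B h \<and> h ` univ A = univ B"

definition embedding :: "'f simtype \<Rightarrow> ('f, 'a) alg \<Rightarrow> ('f, 'b) alg \<Rightarrow> ('a \<Rightarrow> 'b) \<Rightarrow> bool" where
  "embedding \<sigma> A B h \<longleftrightarrow> homom \<sigma> A B h \<and> inj_on h (univ A)"

definition isom :: "'f simtype \<Rightarrow> ('f, 'a) alg \<Rightarrow> ('f, 'b) alg \<Rightarrow> ('a \<Rightarrow> 'b) \<Rightarrow> bool" where
  "isom \<sigma> A B h \<longleftrightarrow> homom \<sigma> A B h \<and> bij_betw h (univ A) (univ B)"

definition isomorphic :: "'f simtype \<Rightarrow> ('f, 'a) alg \<Rightarrow> ('f, 'b) alg \<Rightarrow> bool" where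
  "isomorphic \<sigma> A B \<longleftrightarrow> (\<exists>h. isom \<sigma> A B h)"

definition hom_image :: "'f simtype \<Rightarrow> ('f, 'a) alg \<Rightarrow> ('f, 'b) alg \<Rightarrow> bool" where
  "hom_image \<sigma> A B \<longleftrightarrow> (\<exists>h. surj_homom \<sigma> B A h)"

definition subalgebra :: "'f simtype \<Rightarrow> ('f, 'a) alg \<Rightarrow> ('f, 'a) alg \<Rightarrow> bool" where
  "subalgebra \<sigma> B A \<longleftrightarrow> algebra \<sigma> B \<and> univ B \<subseteq> univ A \<and>
     (\<forall>(f, xs)\<in>args \<sigma> B. interp B f xs = interp A f xs)"


section \<open>Products, quotients and ultraproducts\<close>

definition product_alg :: "'i set \<Rightarrow> ('i \<Rightarrow> ('f, 'a) alg) \<Rightarrow> ('f, 'i \<Rightarrow> 'a) alg" where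
  "product_alg I D =
     \<lparr> univ = (\<Pi>\<^sub>E i\<in>I. univ (D i)),
       interp = (\<lambda>f xs. \<lambda>i\<in>I. interp (D i) f (map (\<lambda>x. x i) xs)) \<rparr>"

text \<open>Meant for congruences \<open>\<theta>\<close>; the operations are then independent of the chosen
  representatives.\<close>

definition quotient_alg :: "('f, 'a) alg \<Rightarrow> ('a \<times> 'a) set \<Rightarrow> ('f, 'a set) alg" where
  "quotient_alg A \<theta> =
     \<lparr> univ = univ A // \<theta>,
       interp = (\<lambda>f cs. \<theta> `` {interp A f (map (\<lambda>c. SOME x. x \<in> c) cs)}) \<rparr>"

definition ultrafilter_on :: "'i set \<Rightarrow> 'i set set \<Rightarrow> bool" where
  "ultrafilter_on I U \<longleftrightarrow> U \<subseteq> Pow I \<and> I \<in> U \<and> {} \<notin> U \<and>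
     (\<forall>X Y. X \<in> U \<and> X \<subseteq> Y \<and> Y \<subseteq> I \<longrightarrow> Y \<in> U) \<and>
     (\<forall>X\<in>U. \<forall>Y\<in>U. X \<inter> Y \<in> U) \<and>
     (\<forall>X. X \<subseteq> I \<longrightarrow> X \<in> U \<or> I - X \<in> U)"

definition ultraproduct ::
  "'i set \<Rightarrow> 'i set set \<Rightarrow> ('i \<Rightarrow> ('f, 'a) alg) \<Rightarrow> ('f, ('i \<Rightarrow> 'a) set) alg" where
  "ultraproduct I U D =
     quotient_alg (product_alg I D)
       {(x, y). x \<in> univ (product_alg I D) \<and> y \<in> univ (product_alg I D) \<and>
                {i \<in> I. x i = y i} \<in> U}"


section \<open>Class operators and the generated quasivariety\<close>

definition class_I :: "'f simtype \<Rightarrow> ('f, 'a) alg set \<Rightarrow> ('f, 'b) alg set" where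
  "class_I \<sigma> K = {B. algebra \<sigma> B \<and> (\<exists>C\<in>K. isomorphic \<sigma> C B)}"

definition class_S :: "'f simtype \<Rightarrow> ('f, 'a) alg set \<Rightarrow> ('f, 'a) alg set" where
  "class_S \<sigma> K = {B. \<exists>C\<in>K. subalgebra \<sigma> B C}"

text \<open>The index set of a product may be empty, so the trivial algebra is a product.\<close>

definition class_P :: "('f, 'a) alg set \<Rightarrow> ('f, 'i \<Rightarrow> 'a) alg set" where
  "class_P K = {product_alg I D |I D. \<forall>i\<in>I. D i \<in> K}"

definition class_Pu :: "('f, 'a) alg set \<Rightarrow> ('f, ('i \<Rightarrow> 'a) set) alg set" where
  "class_Pu K = {ultraproduct I U D |I U D. ultrafilter_on I U \<and> (\<forall>i\<in>I. D i \<in> K)}"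

text \<open>\<open>quasivariety \<sigma> A\<close> consists of the members of \<open>ISPP\<^sub>u(A)\<close> whose universe is a set of
  elements of type \<open>'u\<close>; no relation between \<open>'u\<close> and the type of the elements of \<open>A\<close> is
  assumed. The index sets of the products and ultraproducts are arbitrary subsets of the type
  \<open>('f, 'u) index\<close>. Larger index types give no further algebras \<open>B\<close> over \<open>'u\<close>:
  if \<open>B\<close> embeds in a product of ultrapowers of \<open>A\<close>, then
  for elements \<open>a \<noteq> b\<close> of \<open>B\<close> some homomorphism from \<open>B\<close> to an ultrapower of \<open>A\<close> separates
  \<open>a\<close> and \<open>b\<close>, so factors indexed by pairs of elements of \<open>B\<close> are enough. For each such factor,
  every finite set \<open>F\<close> of true equations \<open>f(xs) = x\<close> of \<open>B\<close> (coded by the triple \<open>(f, xs, x)\<close>)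
  has an assignment from \<open>B\<close> to \<open>A\<close> that respects \<open>F\<close> and separates \<open>a\<close> and \<open>b\<close>, so the
  finite sets \<open>F\<close>, with an ultrafilter that contains all \<open>{G. F \<subseteq> G}\<close>, are enough to index the
  ultrapower.\<close>

type_synonym ('f, 'u) index = "('f \<times> 'u list \<times> 'u) set"

definition quasivariety :: "'f simtype \<Rightarrow> ('f, 'a) alg \<Rightarrow> ('f, 'u) alg set" where
  "quasivariety \<sigma> A =
     class_I \<sigma> (class_S \<sigma>
       (class_P
         (class_Pu {A} :: ('f, (('f, 'u) index \<Rightarrow> 'a) set) alg set)
        :: ('f, ('f, 'u) index \<Rightarrow> (('f, 'u) index \<Rightarrow> 'a) set) alg set))"


section \<open>Subdirect irreducibility and projectivity\<close>

definition subdirect_embedding ::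
  "'f simtype \<Rightarrow> ('f, 'a) alg \<Rightarrow> 'i set \<Rightarrow> ('i \<Rightarrow> ('f, 'b) alg) \<Rightarrow> ('a \<Rightarrow> 'i \<Rightarrow> 'b) \<Rightarrow> bool" where
  "subdirect_embedding \<sigma> A I D h \<longleftrightarrow>
     (\<forall>i\<in>I. algebra \<sigma> (D i)) \<and> embedding \<sigma> A (product_alg I D) h \<and>
     (\<forall>i\<in>I. (\<lambda>a. h a i) ` univ A = univ (D i))"

text \<open>Every subdirect factor of \<open>A\<close> is isomorphic to a quotient of \<open>A\<close>, and factors with the
  same kernel can be identified. So it is no restriction to take the factors over \<open>'a set\<close>
  and to index them by binary relations on \<open>'a\<close>. Only nonempty families are considered, so
  one-element algebras count as subdirectly irreducible.\<close>

definition subdirectly_irreducible :: "'f simtype \<Rightarrow> ('f, 'a) alg \<Rightarrow> bool" where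
  "subdirectly_irreducible \<sigma> A \<longleftrightarrow>
     (\<forall>(I :: ('a \<times> 'a) set set) (D :: ('a \<times> 'a) set \<Rightarrow> ('f, 'a set) alg) h.
        I \<noteq> {} \<and> subdirect_embedding \<sigma> A I D h \<longrightarrow>
        (\<exists>i\<in>I. isom \<sigma> A (D i) (\<lambda>a. h a i)))"

definition weakly_projective_in :: "'f simtype \<Rightarrow> ('f, 'a) alg \<Rightarrow> ('f, 'u) alg set \<Rightarrow> bool" where
  "weakly_projective_in \<sigma> A K \<longleftrightarrow>
     (\<forall>B\<in>K. hom_image \<sigma> A B \<longrightarrow> (\<exists>C. subalgebra \<sigma> C B \<and> isomorphic \<sigma> A C))"

definition projective_in :: "'f simtype \<Rightarrow> ('f, 'a) alg \<Rightarrow> ('f, 'u) alg set \<Rightarrow> bool" where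
  "projective_in \<sigma> A K \<longleftrightarrow>
     (\<forall>B\<in>K. \<forall>f. surj_homom \<sigma> B A f \<longrightarrow>
        (\<exists>g. embedding \<sigma> A B g \<and> (\<forall>a\<in>univ A. f (g a) = a)))"

end

theory Submission
  imports Defs
begin

text \<open>Let \<open>F\<close> be the algebra freely generated by the set \<open>A\<close> in the quasivariety of the
  finite algebra \<open>A\<close>, realised as the subalgebra of the power of \<open>A\<close> with exponent the set of
  all self-maps \<open>h\<close> of \<open>A\<close> that is generated by the tuples \<open>(h(a))\<^sub>h\<close>, one for each \<open>a\<close>. Its
  coordinate \<open>h\<close> is the homomorphism \<open>F \<rightarrow> A\<close> that extends \<open>h\<close>.

  The coordinate at the identity map shows that \<open>A\<close> is a homomorphic image of \<open>F\<close>, so weak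
  projectivity embeds \<open>A\<close> in \<open>F\<close>. The coordinates are jointly injective on the copy of \<open>A\<close>, so
  by subdirect irreducibility a single coordinate \<open>h\<close> is already injective on it
  (\<open>subdirectly_irreducible_injective\<close>). As \<open>A\<close> is finite, the composite \<open>A \<rightarrow> F \<rightarrow> A\<close> is an
  automorphism; precomposing with its inverse gives a section \<open>g\<close> of the coordinate \<open>h\<close>. Thus
  \<open>A\<close> is a retract of a free algebra, and so it is projective: given a surjective homomorphism
  \<open>f : B \<rightarrow> A\<close>, choose for each \<open>a\<close> a preimage \<open>s(a)\<close> under \<open>f\<close>. The map \<open>s \<circ> h\<close> extends to a
  homomorphism \<open>\<Psi> : F \<rightarrow> B\<close> (\<open>free_alg_extension\<close>); the homomorphisms \<open>f \<circ> \<Psi>\<close> and coordinate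
  \<open>h\<close> agree on the generators, hence everywhere, so \<open>\<Psi> \<circ> g\<close> is the required section of \<open>f\<close>.

  Membership in the quasivariety enters only through the following criterion: an algebra lies
  in the quasivariety of the finite algebra \<open>A\<close> if and only if its homomorphisms to \<open>A\<close> separate
  its points (\<open>quasivariety_iff_separated\<close>). Ultraproducts disappear because every ultrapower
  of a finite algebra embeds in that algebra.\<close>


section \<open>Homomorphisms and copies of algebras\<close>

lemma args_iff: "(f, xs) \<in> args \<sigma> A \<longleftrightarrow> \<sigma> f = Some (length xs) \<and> set xs \<subseteq> univ A"
  by (simp add: args_def)

lemma algebra_closed: "algebra \<sigma> A \<Longrightarrow> (f, xs) \<in> args \<sigma> A \<Longrightarrow> interp A f xs \<in> univ A"
  by (auto simp: algebra_def)

lemma homomI: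
  assumes "\<And>a. a \<in> univ A \<Longrightarrow> h a \<in> univ B"
    and "\<And>f xs. (f, xs) \<in> args \<sigma> A \<Longrightarrow> h (interp A f xs) = interp B f (map h xs)"
  shows "homom \<sigma> A B h"
  using assms by (auto simp: homom_def)

lemma homom_in: "homom \<sigma> A B h \<Longrightarrow> a \<in> univ A \<Longrightarrow> h a \<in> univ B"
  by (auto simp: homom_def)

lemma homom_interp:
  "homom \<sigma> A B h \<Longrightarrow> (f, xs) \<in> args \<sigma> A \<Longrightarrow> h (interp A f xs) = interp B f (map h xs)"
  by (auto simp: homom_def)

lemma homom_args: "homom \<sigma> A B h \<Longrightarrow> (f, xs) \<in> args \<sigma> A \<Longrightarrow> (f, map h xs) \<in> args \<sigma> B"
  by (auto simp: args_iff dest: homom_in)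

lemma homom_comp:
  assumes h: "homom \<sigma> A B h" and k: "homom \<sigma> B C k"
  shows "homom \<sigma> A C (\<lambda>a. k (h a))"
proof (rule homomI)
  fix f xs assume "(f, xs) \<in> args \<sigma> A"
  then show "k (h (interp A f xs)) = interp C f (map (\<lambda>a. k (h a)) xs)"
    by (simp add: homom_interp[OF h] homom_interp[OF k] homom_args[OF h] comp_def)
qed (use h k in \<open>auto dest: homom_in\<close>)

lemma homom_subalgebra: "subalgebra \<sigma> C B \<Longrightarrow> homom \<sigma> C B (\<lambda>x. x)"
  by (rule homomI) (auto simp: subalgebra_def)

lemma isom_inverse:
  assumes A: "algebra \<sigma> A" and h: "isom \<sigma> A B h"
  shows "isom \<sigma> B A (inv_into (univ A) h)"
proof -
  let ?k = "inv_into (univ A) h"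
  have hom: "homom \<sigma> A B h" and inj: "inj_on h (univ A)" and im: "h ` univ A = univ B"
    using h by (auto simp: isom_def bij_betw_def)
  have k: "?k b \<in> univ A" "h (?k b) = b" if "b \<in> univ B" for b
    using that im by (auto simp: inv_into_into f_inv_into_f)
  have "homom \<sigma> B A ?k"
  proof (rule homomI)
    fix f ys assume ys: "(f, ys) \<in> args \<sigma> B"
    then have xs: "(f, map ?k ys) \<in> args \<sigma> A"
      using k by (auto simp: args_iff)
    have "map h (map ?k ys) = ys"
      using ys k by (auto simp: args_iff intro!: map_idI)
    then have "h (interp A f (map ?k ys)) = interp B f ys"
      using homom_interp[OF hom xs] by simp
    then show "?k (interp B f ys) = interp A f (map ?k ys)"
      using inv_into_f_f[OF inj algebra_closed[OF A xs]] by simp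
  qed (rule k)
  moreover have "bij_betw ?k (univ B) (univ A)"
    using h by (auto simp: isom_def intro: bij_betw_inv_into)
  ultimately show ?thesis by (simp add: isom_def)
qed

lemma embedding_image:
  assumes B: "algebra \<sigma> B" and e: "embedding \<sigma> B P e"
  shows "subalgebra \<sigma> (P\<lparr>univ := e ` univ B\<rparr>) P"
    and "isom \<sigma> B (P\<lparr>univ := e ` univ B\<rparr>) e"
proof -
  let ?C = "P\<lparr>univ := e ` univ B\<rparr>"
  have hom: "homom \<sigma> B P e" and inj: "inj_on e (univ B)"
    using e by (auto simp: embedding_def)
  have "interp P f ys \<in> e ` univ B" if ys: "(f, ys) \<in> args \<sigma> ?C" for f ys
  proof -
    have "ys \<in> lists (e ` univ B)" using ys by (auto simp: args_iff)
    then obtain xs where xs: "ys = map e xs" "set xs \<subseteq> univ B"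
      by (auto simp: lists_image)
    then have *: "(f, xs) \<in> args \<sigma> B" using ys by (auto simp: args_iff)
    show ?thesis
      using homom_interp[OF hom *] imageI[OF algebra_closed[OF B *], of e] xs by simp
  qed
  then show "subalgebra \<sigma> ?C P"
    using B homom_in[OF hom] by (auto simp: subalgebra_def algebra_def)
  show "isom \<sigma> B ?C e"
    using hom inj by (auto simp: isom_def homom_def bij_betw_def)
qed

lemma algebra_copy:
  assumes A: "algebra \<sigma> A" and k: "inj_on k (univ A)"
  obtains B where "algebra \<sigma> B" and "isom \<sigma> A B k"
proof
  let ?B = "\<lparr>univ = k ` univ A, interp = \<lambda>f ys. k (interp A f (map (inv_into (univ A) k) ys))\<rparr>"
  have "(f, map (inv_into (univ A) k) ys) \<in> args \<sigma> A" if "(f, ys) \<in> args \<sigma> ?B" for f ys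
    using that by (auto simp: args_iff intro: inv_into_into)
  then show "algebra \<sigma> ?B"
    using A algebra_closed[OF A] by (fastforce simp: algebra_def)
  have "homom \<sigma> A ?B k"
  proof (rule homomI)
    fix f xs assume xs: "(f, xs) \<in> args \<sigma> A"
    have "map (inv_into (univ A) k) (map k xs) = xs"
      using xs k by (auto simp: args_iff intro!: map_idI)
    then show "k (interp A f xs) = interp ?B f (map k xs)" by simp
  qed auto
  then show "isom \<sigma> A ?B k"
    using k by (auto simp: isom_def bij_betw_def)
qed

lemma homom_product_coordinate:
  "i \<in> I \<Longrightarrow> homom \<sigma> (product_alg I D) (D i) (\<lambda>x. x i)"
  by (rule homomI) (auto simp: product_alg_def)

lemma homom_into_product:
  assumes "\<And>i. i \<in> I \<Longrightarrow> homom \<sigma> B (D i) (q i)"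
  shows "homom \<sigma> B (product_alg I D) (\<lambda>b. \<lambda>i\<in>I. q i b)"
proof (rule homomI)
  fix f xs assume xs: "(f, xs) \<in> args \<sigma> B"
  show "(\<lambda>i\<in>I. q i (interp B f xs)) = interp (product_alg I D) f (map (\<lambda>b. \<lambda>i\<in>I. q i b) xs)"
    using homom_interp[OF assms xs]
    by (auto simp: product_alg_def comp_def fun_eq_iff restrict_def)
qed (use homom_in[OF assms] in \<open>auto simp: product_alg_def\<close>)


section \<open>Ultrapowers of finite algebras\<close>

lemma ultrafilter_mono:
  assumes "ultrafilter_on I U" "X \<in> U" "X \<subseteq> Y" "Y \<subseteq> I" shows "Y \<in> U"
proof -
  have "\<forall>X Y. X \<in> U \<and> X \<subseteq> Y \<and> Y \<subseteq> I \<longrightarrow> Y \<in> U"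
    using assms(1) unfolding ultrafilter_on_def by (elim conjE)
  then show ?thesis using assms(2-) by metis
qed

lemma ultrafilter_Int:
  assumes "ultrafilter_on I U" "X \<in> U" "Y \<in> U" shows "X \<inter> Y \<in> U"
  using assms(2,3) assms(1)[unfolded ultrafilter_on_def] by simp

lemma ultrafilter_compl:
  assumes "ultrafilter_on I U" "X \<subseteq> I" "X \<notin> U" shows "I - X \<in> U"
proof -
  have "\<forall>X. X \<subseteq> I \<longrightarrow> X \<in> U \<or> I - X \<in> U"
    using assms(1) unfolding ultrafilter_on_def by (elim conjE)
  then show ?thesis using assms(2-) by metis
qed

lemma ultrafilter_finite_Union:
  assumes U: "ultrafilter_on I U" and fin: "finite S"
    and sub: "\<And>X. X \<in> S \<Longrightarrow> X \<subseteq> I" and un: "\<Union>S \<in> U"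
  shows "\<exists>X\<in>S. X \<in> U"
  using fin sub un
proof (induction S rule: finite_induct)
  case empty
  then show ?case using U by (simp add: ultrafilter_on_def)
next
  case (insert X S)
  show ?case
  proof (cases "X \<in> U")
    case False
    have "X \<subseteq> I" "\<Union>S \<subseteq> I" using insert.prems(1) by blast+
    have "(I - X) \<inter> \<Union>(insert X S) \<in> U"
      using ultrafilter_Int[OF U ultrafilter_compl[OF U \<open>X \<subseteq> I\<close> False] insert.prems(2)] .
    from ultrafilter_mono[OF U this _ \<open>\<Union>S \<subseteq> I\<close>] have "\<Union>S \<in> U" by blast
    then show ?thesis using insert.IH insert.prems(1) by blast
  qed auto
qed

text \<open>The value of a class is the limit along \<open>U\<close> of any representative: the element that it
  takes on a set of the ultrafilter. It exists because the finitely many level sets of a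
  representative cover the index set.\<close>

lemma ultrapower_embeds:
  assumes A: "algebra \<sigma> A" and fin: "finite (univ A)"
    and U: "ultrafilter_on I U" and D: "\<forall>i\<in>I. D i = A"
  obtains v where "embedding \<sigma> (ultraproduct I U D) A v"
proof -
  let ?P = "product_alg I D"
  define \<theta> where "\<theta> = {(x, y). x \<in> univ ?P \<and> y \<in> univ ?P \<and> {i \<in> I. x i = y i} \<in> U}"
  have up: "ultraproduct I U D = quotient_alg ?P \<theta>"
    by (simp add: ultraproduct_def \<theta>_def)
  have I: "I \<in> U" and ne: "{} \<notin> U"
    and mono: "\<And>X Y. X \<in> U \<Longrightarrow> X \<subseteq> Y \<Longrightarrow> Y \<subseteq> I \<Longrightarrow> Y \<in> U"
    and int: "\<And>X Y. X \<in> U \<Longrightarrow> Y \<in> U \<Longrightarrow> X \<inter> Y \<in> U"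
    using U ultrafilter_mono[OF U] ultrafilter_Int[OF U] by (simp_all add: ultrafilter_on_def)
  have P_in: "x i \<in> univ A" if "x \<in> univ ?P" "i \<in> I" for x i
    using that D by (auto simp: product_alg_def PiE_def Pi_def)
  have equiv: "equiv (univ ?P) \<theta>"
  proof (rule equivI)
    show "trans \<theta>"
    proof (rule transI)
      fix x y z assume "(x, y) \<in> \<theta>" "(y, z) \<in> \<theta>"
      moreover from this have "{i \<in> I. x i = y i} \<inter> {i \<in> I. y i = z i} \<in> U"
        by (simp add: \<theta>_def int)
      then have "{i \<in> I. x i = z i} \<in> U" by (rule mono) auto
      ultimately show "(x, z) \<in> \<theta>" by (simp add: \<theta>_def)
    qed
  qed (use I in \<open>auto simp: \<theta>_def refl_on_def sym_def eq_commute\<close>)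
  define lim where "lim x = (SOME a. a \<in> univ A \<and> {i \<in> I. x i = a} \<in> U)" for x
  have lim: "lim x \<in> univ A" "{i \<in> I. x i = lim x} \<in> U" if x: "x \<in> univ ?P" for x
  proof -
    let ?S = "(\<lambda>a. {i \<in> I. x i = a}) ` univ A"
    have "\<Union>?S = I" using P_in[OF x] by blast
    then have "\<exists>X\<in>?S. X \<in> U"
      using fin I by (intro ultrafilter_finite_Union[OF U]) auto
    then have "\<exists>a. a \<in> univ A \<and> {i \<in> I. x i = a} \<in> U" by blast
    from someI_ex[OF this] show "lim x \<in> univ A" "{i \<in> I. x i = lim x} \<in> U"
      by (auto simp: lim_def)
  qed
  have lim_unique: "lim x = a" if x: "x \<in> univ ?P" and X: "{i \<in> I. x i = a} \<in> U" for x a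
  proof (rule ccontr)
    assume "lim x \<noteq> a"
    then have "{i \<in> I. x i = lim x} \<inter> {i \<in> I. x i = a} = {}" by auto
    then show False using int[OF lim(2)[OF x] X] ne by simp
  qed
  have lim_eq: "lim x = lim y \<longleftrightarrow> (x, y) \<in> \<theta>" if x: "x \<in> univ ?P" and y: "y \<in> univ ?P" for x y
  proof
    assume "lim x = lim y"
    then have "{i \<in> I. x i = lim x} \<inter> {i \<in> I. y i = lim y} \<subseteq> {i \<in> I. x i = y i}" by auto
    from mono[OF int[OF lim(2)[OF x] lim(2)[OF y]] this]
    show "(x, y) \<in> \<theta>" using x y by (auto simp: \<theta>_def)
  next
    assume "(x, y) \<in> \<theta>"
    then have "{i \<in> I. x i = y i} \<inter> {i \<in> I. y i = lim y} \<in> U"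
      by (intro int lim(2)[OF y]) (simp add: \<theta>_def)
    then have "{i \<in> I. x i = lim y} \<in> U" by (rule mono) auto
    then show "lim x = lim y" by (rule lim_unique[OF x])
  qed
  let ?r = "\<lambda>c. SOME x. x \<in> c"
  have r: "?r c \<in> univ ?P" "c = \<theta> `` {?r c}" if c: "c \<in> univ ?P // \<theta>" for c
  proof -
    have "?r c \<in> c"
      using in_quotient_imp_non_empty[OF equiv c] by (simp add: some_in_eq)
    moreover obtain x where x: "c = \<theta> `` {x}" using c by (auto elim: quotientE)
    ultimately have rel: "(x, ?r c) \<in> \<theta>" by simp
    then show "?r c \<in> univ ?P" unfolding \<theta>_def by blast
    show "c = \<theta> `` {?r c}" using trans[OF x equiv_class_eq[OF equiv rel]] .
  qed
  have hom: "homom \<sigma> (ultraproduct I U D) A (\<lambda>c. lim (?r c))"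
  proof (rule homomI)
    fix f cs assume cs: "(f, cs) \<in> args \<sigma> (ultraproduct I U D)"
    define xs where "xs = map ?r cs"
    define z where "z = interp ?P f xs"
    have xs: "set xs \<subseteq> univ ?P" "\<sigma> f = Some (length xs)"
      using cs r by (auto simp: args_iff up quotient_alg_def xs_def)
    have z_eq: "z i = interp A f (map (\<lambda>x. x i) xs)" if "i \<in> I" for i
      using that D by (simp add: z_def product_alg_def)
    have z: "z \<in> univ ?P"
    proof -
      have "z i \<in> univ A" if "i \<in> I" for i
        unfolding z_eq[OF that] using xs P_in that
        by (intro algebra_closed[OF A]) (auto simp: args_iff)
      then show ?thesis
        using D by (auto simp: z_def product_alg_def)
    qed
    have "{i \<in> I. \<forall>x\<in>set xs. x i = lim x} \<in> U" using xs(1)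
    proof (induction xs)
      case Nil
      then show ?case using I by simp
    next
      case (Cons x xs)
      then have "{i \<in> I. x i = lim x} \<inter> {i \<in> I. \<forall>x\<in>set xs. x i = lim x} \<in> U"
        by (intro int lim(2)) simp_all
      then show ?case by (rule mono) auto
    qed
    moreover have "{i \<in> I. \<forall>x\<in>set xs. x i = lim x} \<subseteq> {i \<in> I. z i = interp A f (map lim xs)}"
      using z_eq by (auto cong: map_cong)
    ultimately have "{i \<in> I. z i = interp A f (map lim xs)} \<in> U"
      by (rule mono) blast
    then have lim_z: "lim z = interp A f (map lim xs)" by (rule lim_unique[OF z])
    have cz: "\<theta> `` {z} \<in> univ ?P // \<theta>" using z by (rule quotientI)
    have "(z, ?r (\<theta> `` {z})) \<in> \<theta>"
      using r[OF cz] eq_equiv_class_iff[OF equiv z] by auto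
    then have "lim (?r (\<theta> `` {z})) = lim z"
      using lim_eq[OF z r(1)[OF cz]] by simp
    moreover have "interp (ultraproduct I U D) f cs = \<theta> `` {z}"
      by (simp add: up quotient_alg_def z_def xs_def)
    ultimately show "lim (?r (interp (ultraproduct I U D) f cs))
        = interp A f (map (\<lambda>c. lim (?r c)) cs)"
      using lim_z by (simp add: xs_def comp_def)
  qed (use lim r in \<open>auto simp: up quotient_alg_def\<close>)
  have "inj_on (\<lambda>c. lim (?r c)) (univ ?P // \<theta>)"
  proof (rule inj_onI)
    fix c d assume c: "c \<in> univ ?P // \<theta>" and d: "d \<in> univ ?P // \<theta>" and "lim (?r c) = lim (?r d)"
    then have "(?r c, ?r d) \<in> \<theta>" using lim_eq r by blast
    then have "\<theta> `` {?r c} = \<theta> `` {?r d}" by (rule equiv_class_eq[OF equiv])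
    then show "c = d" using r(2)[OF c] r(2)[OF d] by simp
  qed
  with hom show ?thesis
    by (intro that) (simp add: embedding_def up quotient_alg_def)
qed

text \<open>Over a one-element index set the ultrapower congruence is equality, so its classes are the
  singletons.\<close>

lemma embeds_in_trivial_ultrapower:
  assumes A: "algebra \<sigma> A"
  shows "ultrafilter_on {j} {{j}}"
    and "embedding \<sigma> A (ultraproduct {j} {{j}} (\<lambda>_. A)) (\<lambda>a. {\<lambda>i\<in>{j}. a})"
proof -
  show "ultrafilter_on {j} {{j}}"
    by (auto simp: ultrafilter_on_def)
  let ?P = "product_alg {j} (\<lambda>_. A)"
  let ?c = "\<lambda>a. \<lambda>i\<in>{j}. a"
  have "{i \<in> {j}. x i = y i} \<in> {{j}} \<longleftrightarrow> x = y" if "x \<in> univ ?P" "y \<in> univ ?P" for x y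
    using that by (auto simp: product_alg_def intro: PiE_ext)
  then have up: "ultraproduct {j} {{j}} (\<lambda>_. A) = quotient_alg ?P (Id_on (univ ?P))"
    unfolding ultraproduct_def by (intro arg_cong[where f = "quotient_alg ?P"]) (auto simp: Id_on_iff)
  have c: "?c a \<in> univ ?P" if "a \<in> univ A" for a
    using that by (auto simp: product_alg_def)
  have cls: "Id_on (univ ?P) `` {x} = {x}" if "x \<in> univ ?P" for x
    using that by auto
  have "homom \<sigma> A (ultraproduct {j} {{j}} (\<lambda>_. A)) (\<lambda>a. {?c a})"
    unfolding up
  proof (rule homomI)
    fix a assume "a \<in> univ A"
    then show "{?c a} \<in> univ (quotient_alg ?P (Id_on (univ ?P)))"
      using quotientI[OF c, of a "Id_on (univ ?P)"] cls[OF c] by (simp add: quotient_alg_def)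
  next
    fix f xs assume xs: "(f, xs) \<in> args \<sigma> A"
    have "map (\<lambda>c. SOME x. x \<in> c) (map (\<lambda>a. {?c a}) xs) = map ?c xs"
      by simp
    moreover have "interp ?P f (map ?c xs) = ?c (interp A f xs)"
      by (auto simp: product_alg_def comp_def)
    ultimately show "{?c (interp A f xs)}
        = interp (quotient_alg ?P (Id_on (univ ?P))) f (map (\<lambda>a. {?c a}) xs)"
      using cls[OF c[OF algebra_closed[OF A xs]]] by (simp add: quotient_alg_def del: map_map)
  qed
  moreover have "inj_on (\<lambda>a. {?c a}) (univ A)"
    by (rule inj_onI) (metis restrict_apply' singletonI singleton_inject)
  ultimately show "embedding \<sigma> A (ultraproduct {j} {{j}} (\<lambda>_. A)) (\<lambda>a. {?c a})"
    by (simp add: embedding_def)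
qed


section \<open>The quasivariety of a finite algebra\<close>

definition separated_by :: "'f simtype \<Rightarrow> ('f, 'a) alg \<Rightarrow> ('f, 'b) alg \<Rightarrow> bool" where
  "separated_by \<sigma> A B \<longleftrightarrow>
     (\<forall>b\<in>univ B. \<forall>c\<in>univ B. b \<noteq> c \<longrightarrow> (\<exists>p. homom \<sigma> B A p \<and> p b \<noteq> p c))"

lemma separated_by_embedding:
  assumes e: "embedding \<sigma> C B e" and B: "separated_by \<sigma> A B"
  shows "separated_by \<sigma> A C"
  unfolding separated_by_def
proof (intro ballI impI)
  fix b c assume "b \<in> univ C" "c \<in> univ C" "b \<noteq> c"
  then have "e b \<in> univ B" "e c \<in> univ B" "e b \<noteq> e c"
    using e by (auto simp: embedding_def dest: homom_in inj_onD)
  then obtain p where "homom \<sigma> B A p" "p (e b) \<noteq> p (e c)"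
    using B by (auto simp: separated_by_def)
  moreover have "homom \<sigma> C B e" using e by (simp add: embedding_def)
  ultimately show "\<exists>p. homom \<sigma> C A p \<and> p b \<noteq> p c"
    using homom_comp by blast
qed

lemma separated_by_product:
  assumes "\<And>i. i \<in> I \<Longrightarrow> separated_by \<sigma> A (D i)"
  shows "separated_by \<sigma> A (product_alg I D)"
  unfolding separated_by_def
proof (intro ballI impI)
  fix x y assume x: "x \<in> univ (product_alg I D)" and y: "y \<in> univ (product_alg I D)" and "x \<noteq> y"
  then obtain i where i: "i \<in> I" "x i \<noteq> y i"
    using PiE_ext[of x I "\<lambda>i. univ (D i)" y] by (auto simp: product_alg_def)
  note c = homom_product_coordinate[OF i(1), of \<sigma> D]
  obtain p where "homom \<sigma> (D i) A p" "p (x i) \<noteq> p (y i)"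
    using assms[OF i(1)] i(2) homom_in[OF c x] homom_in[OF c y] by (auto simp: separated_by_def)
  then show "\<exists>p. homom \<sigma> (product_alg I D) A p \<and> p x \<noteq> p y"
    using homom_comp[OF c] by blast
qed

lemma class_PuI:
  "ultrafilter_on I U \<Longrightarrow> (\<And>i. i \<in> I \<Longrightarrow> D i \<in> K) \<Longrightarrow> ultraproduct I U D \<in> class_Pu K"
  unfolding class_Pu_def by (intro CollectI exI[of _ I] exI[of _ U] exI[of _ D]) simp

lemma class_PI: "(\<And>i. i \<in> I \<Longrightarrow> D i \<in> K) \<Longrightarrow> product_alg I D \<in> class_P K"
  unfolding class_P_def by (intro CollectI exI[of _ I] exI[of _ D]) simp

text \<open>Pairs of distinct points of \<open>B\<close>, each with a homomorphism that separates it, index the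
  factors of a power of \<open>A\<close> that contains \<open>B\<close>. To be of the form \<open>ISPP\<^sub>u\<close>, each factor is
  replaced by the ultrapower of \<open>A\<close> over a one-element index set.\<close>

lemma quasivariety_if_separated:
  fixes B :: "('f, 'u) alg"
  assumes A: "algebra \<sigma> A" and B: "algebra \<sigma> B" and sep: "separated_by \<sigma> A B"
  shows "B \<in> quasivariety \<sigma> A"
proof -
  \<comment> \<open>A pair is coded as a singleton; the operation symbol in it is arbitrary.\<close>
  define code :: "'u \<Rightarrow> 'u \<Rightarrow> ('f, 'u) index" where "code b c = {(undefined, [b], c)}" for b c
  have code_inj: "code b c = code b' c' \<longleftrightarrow> b = b' \<and> c = c'" for b c b' c'
    by (auto simp: code_def)
  define I where "I = {code b c |b c. b \<in> univ B \<and> c \<in> univ B \<and> b \<noteq> c}"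
  have "\<exists>p. homom \<sigma> B A p \<and> (\<forall>b c. i = code b c \<longrightarrow> p b \<noteq> p c)" if i: "i \<in> I" for i
  proof -
    obtain b c where bc: "i = code b c" "b \<in> univ B" "c \<in> univ B" "b \<noteq> c"
      using i by (auto simp: I_def)
    then obtain p where "homom \<sigma> B A p" "p b \<noteq> p c"
      using sep unfolding separated_by_def by blast
    then show ?thesis unfolding bc(1) code_inj by blast
  qed
  then obtain q where q: "\<And>i. i \<in> I \<Longrightarrow> homom \<sigma> B A (q i)"
    and q_sep: "\<And>b c. code b c \<in> I \<Longrightarrow> q (code b c) b \<noteq> q (code b c) c"
    by metis
  define A' where "A' = ultraproduct {{} :: ('f, 'u) index} {{{}}} (\<lambda>_. A)"
  obtain \<iota> where \<iota>: "embedding \<sigma> A A' \<iota>"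
    using embeds_in_trivial_ultrapower(2)[OF A, of "{} :: ('f, 'u) index", folded A'_def] ..
  have "A' \<in> class_Pu {A}"
    unfolding A'_def by (rule class_PuI[OF embeds_in_trivial_ultrapower(1)[OF A]]) simp
  then have P: "product_alg I (\<lambda>_. A') \<in> class_P (class_Pu {A})"
    by (intro class_PI)
  define e where "e b = (\<lambda>i\<in>I. \<iota> (q i b))" for b
  have "homom \<sigma> B (product_alg I (\<lambda>_. A')) e"
    unfolding e_def using homom_comp[OF q] \<iota>
    by (intro homom_into_product) (auto simp: embedding_def)
  moreover have "inj_on e (univ B)"
  proof (rule inj_onI, rule ccontr)
    fix b c assume b: "b \<in> univ B" and c: "c \<in> univ B" and eq: "e b = e c" and "b \<noteq> c"
    then have i: "code b c \<in> I" by (auto simp: I_def)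
    have "\<iota> (q (code b c) b) = \<iota> (q (code b c) c)"
      using fun_cong[OF eq, of "code b c"] i by (simp add: e_def)
    then have "q (code b c) b = q (code b c) c"
      using \<iota> homom_in[OF q[OF i]] b c by (auto simp: embedding_def dest: inj_onD)
    then show False using q_sep[OF i] by simp
  qed
  ultimately have e: "embedding \<sigma> B (product_alg I (\<lambda>_. A')) e"
    by (simp add: embedding_def)
  note im = embedding_image[OF B e]
  let ?C = "(product_alg I (\<lambda>_. A'))\<lparr>univ := e ` univ B\<rparr>"
  have "isomorphic \<sigma> ?C B"
    using isom_inverse[OF B im(2)] by (auto simp: isomorphic_def)
  moreover have "?C \<in> class_S \<sigma> (class_P (class_Pu {A}))"
    using im(1) P by (auto simp: class_S_def)
  ultimately show ?thesis
    using B by (auto simp: quasivariety_def class_I_def)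
qed

lemma quasivariety_iff_separated:
  fixes A :: "('f, 'a) alg" and B :: "('f, 'u) alg"
  assumes A: "algebra \<sigma> A" and fin: "finite (univ A)"
  shows "B \<in> quasivariety \<sigma> A \<longleftrightarrow> algebra \<sigma> B \<and> separated_by \<sigma> A B"
proof
  assume "B \<in> quasivariety \<sigma> A"
  then obtain P C h where B: "algebra \<sigma> B"
    and P: "P \<in> class_P (class_Pu {A} :: ('f, (('f, 'u) index \<Rightarrow> 'a) set) alg set)"
    and C: "subalgebra \<sigma> C (P :: ('f, ('f, 'u) index \<Rightarrow> (('f, 'u) index \<Rightarrow> 'a) set) alg)"
    and h: "isom \<sigma> C B h"
    by (auto simp: quasivariety_def class_I_def class_S_def isomorphic_def)
  have "separated_by \<sigma> A A"
    unfolding separated_by_def using homomI[of A "\<lambda>x. x" A \<sigma>] by auto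
  then have "separated_by \<sigma> A (ultraproduct J U D)"
    if "ultrafilter_on J U" "\<forall>j\<in>J. D j = A" for J :: "('f, 'u) index set" and U D
    using ultrapower_embeds[OF A fin that] separated_by_embedding by metis
  then have "separated_by \<sigma> A E" if "E \<in> class_Pu {A}"
    for E :: "('f, (('f, 'u) index \<Rightarrow> 'a) set) alg"
    using that by (auto simp only: class_Pu_def mem_Collect_eq singleton_iff)
  then have "separated_by \<sigma> A P"
    using P by (auto simp: class_P_def intro: separated_by_product)
  moreover have "embedding \<sigma> C P (\<lambda>x. x)"
    using homom_subalgebra[OF C] by (simp add: embedding_def)
  moreover have "embedding \<sigma> B C (inv_into (univ C) h)"
    using isom_inverse[OF _ h] C by (auto simp: subalgebra_def embedding_def isom_def bij_betw_def)
  ultimately show "algebra \<sigma> B \<and> separated_by \<sigma> A B"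
    using B by (blast intro: separated_by_embedding)
qed (use quasivariety_if_separated[OF A] in blast)


section \<open>The free algebra\<close>

text \<open>The self-maps are taken to be extensional: this makes the exponent, hence the power of \<open>A\<close>
  and the free algebra, finite when \<open>A\<close> is finite.\<close>

abbreviation self_maps :: "('f, 'a) alg \<Rightarrow> ('a \<Rightarrow> 'a) set" where
  "self_maps A \<equiv> univ A \<rightarrow>\<^sub>E univ A"

abbreviation free_gen :: "('f, 'a) alg \<Rightarrow> 'a \<Rightarrow> ('a \<Rightarrow> 'a) \<Rightarrow> 'a" where
  "free_gen A a \<equiv> (\<lambda>h\<in>self_maps A. h a)"

inductive_set free_univ :: "'f simtype \<Rightarrow> ('f, 'a) alg \<Rightarrow> (('a \<Rightarrow> 'a) \<Rightarrow> 'a) set"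
  for \<sigma> A where
  gen: "a \<in> univ A \<Longrightarrow> free_gen A a \<in> free_univ \<sigma> A"
| op: "\<sigma> f = Some (length xs) \<Longrightarrow> (\<And>x. x \<in> set xs \<Longrightarrow> x \<in> free_univ \<sigma> A) \<Longrightarrow>
    interp (product_alg (self_maps A) (\<lambda>_. A)) f xs \<in> free_univ \<sigma> A"

definition free_alg :: "'f simtype \<Rightarrow> ('f, 'a) alg \<Rightarrow> ('f, ('a \<Rightarrow> 'a) \<Rightarrow> 'a) alg" where
  "free_alg \<sigma> A = (product_alg (self_maps A) (\<lambda>_. A))\<lparr>univ := free_univ \<sigma> A\<rparr>"

lemma product_closed:
  assumes "\<And>i. i \<in> I \<Longrightarrow> algebra \<sigma> (D i)" and xs: "(f, xs) \<in> args \<sigma> (product_alg I D)"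
  shows "interp (product_alg I D) f xs \<in> univ (product_alg I D)"
proof -
  have "interp (D i) f (map (\<lambda>x. x i) xs) \<in> univ (D i)" if "i \<in> I" for i
    using homom_args[OF homom_product_coordinate[OF that] xs] assms(1)[OF that]
    by (rule algebra_closed[rotated])
  then show ?thesis by (simp add: product_alg_def)
qed

lemma subalgebra_free_alg:
  assumes A: "algebra \<sigma> A"
  shows "subalgebra \<sigma> (free_alg \<sigma> A) (product_alg (self_maps A) (\<lambda>_. A))" (is "subalgebra \<sigma> _ ?P")
proof -
  have "x \<in> univ ?P" if "x \<in> free_univ \<sigma> A" for x
    using that
  proof induction
    case (gen a)
    then show ?case
      by (simp only: product_alg_def alg.select_convs restrict_PiE_iff) (blast dest: PiE_mem)
  next
    case (op f xs)
    then show ?case by (intro product_closed[where \<sigma> = \<sigma>]) (auto simp: args_iff A)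
  qed
  moreover have "free_univ \<sigma> A \<noteq> {}"
    using A free_univ.gen by (fastforce simp: algebra_def)
  ultimately show ?thesis
    by (auto simp: subalgebra_def algebra_def free_alg_def args_iff intro!: free_univ.op)
qed

lemma homom_free_coordinate:
  "algebra \<sigma> A \<Longrightarrow> h \<in> self_maps A \<Longrightarrow> homom \<sigma> (free_alg \<sigma> A) A (\<lambda>x. x h)"
  using homom_comp[OF homom_subalgebra[OF subalgebra_free_alg] homom_product_coordinate] .

lemma free_alg_eqI:
  assumes "algebra \<sigma> A" and "x \<in> univ (free_alg \<sigma> A)" and "y \<in> univ (free_alg \<sigma> A)"
    and "\<And>h. h \<in> self_maps A \<Longrightarrow> x h = y h"
  shows "x = y"
proof (rule PiE_ext)
  let ?P = "product_alg (self_maps A) (\<lambda>_. A)"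
  have "univ (free_alg \<sigma> A) \<subseteq> univ ?P"
    using subalgebra_free_alg[OF assms(1)] by (simp add: subalgebra_def)
  then show "x \<in> self_maps A \<rightarrow>\<^sub>E univ A" "y \<in> self_maps A \<rightarrow>\<^sub>E univ A"
    using assms(2,3) by (auto simp: product_alg_def)
qed (rule assms(4))

lemma finite_free_alg:
  assumes A: "algebra \<sigma> A" and fin: "finite (univ A)"
  shows "finite (univ (free_alg \<sigma> A))"
proof (rule finite_subset)
  show "univ (free_alg \<sigma> A) \<subseteq> univ (product_alg (self_maps A) (\<lambda>_. A))"
    using subalgebra_free_alg[OF A] by (simp add: subalgebra_def)
  show "finite (univ (product_alg (self_maps A) (\<lambda>_. A)))"
    using fin by (auto simp: product_alg_def intro!: finite_PiE)
qed

lemma homom_eq_on_free_alg: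
  assumes p: "homom \<sigma> (free_alg \<sigma> A) B p" and q: "homom \<sigma> (free_alg \<sigma> A) B q"
    and gens: "\<And>a. a \<in> univ A \<Longrightarrow> p (free_gen A a) = q (free_gen A a)"
    and x: "x \<in> univ (free_alg \<sigma> A)"
  shows "p x = q x"
proof -
  have "x \<in> free_univ \<sigma> A" using x by (simp add: free_alg_def)
  then show ?thesis
  proof induction
    case (gen a)
    then show ?case by (rule gens)
  next
    case (op f xs)
    then have xs: "(f, xs) \<in> args \<sigma> (free_alg \<sigma> A)" by (auto simp: args_iff free_alg_def)
    have "map p xs = map q xs" using op by auto
    then have "p (interp (free_alg \<sigma> A) f xs) = q (interp (free_alg \<sigma> A) f xs)"
      using homom_interp[OF p xs] homom_interp[OF q xs] by (simp only:)
    then show ?case by (simp add: free_alg_def)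
  qed
qed

text \<open>For every homomorphism \<open>p : B \<rightarrow> A\<close>, the composite of \<open>p\<close> with the extension of \<open>t\<close> must be
  the coordinate at the self-map \<open>p \<circ> t\<close> of \<open>A\<close>. As such \<open>p\<close> separate the points of \<open>B\<close>, this
  determines the extension. An element of \<open>B\<close> with the required images under all \<open>p\<close> is
  found by induction along the generation of the free algebra.\<close>

lemma free_alg_extension:
  assumes A: "algebra \<sigma> A" and B: "algebra \<sigma> B" and sep: "separated_by \<sigma> A B"
    and t: "t \<in> univ A \<rightarrow> univ B"
  obtains \<Psi> where "homom \<sigma> (free_alg \<sigma> A) B \<Psi>"
    and "\<And>a. a \<in> univ A \<Longrightarrow> \<Psi> (free_gen A a) = t a"
proof -
  let ?F = "free_alg \<sigma> A"
  let ?ev = "\<lambda>p. \<lambda>a\<in>univ A. p (t a)"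
  let ?rel = "\<lambda>x b. b \<in> univ B \<and> (\<forall>p. homom \<sigma> B A p \<longrightarrow> p b = x (?ev p))"
  have ev: "?ev p \<in> self_maps A" if "homom \<sigma> B A p" for p
    using t homom_in[OF that] by auto
  have rel_unique: "b = c" if "?rel x b" "?rel x c" for x b c
    using that sep by (fastforce simp: separated_by_def)
  have rel_gen: "?rel (free_gen A a) (t a)" if "a \<in> univ A" for a
  proof (intro conjI allI impI)
    fix p assume "homom \<sigma> B A p"
    then show "p (t a) = free_gen A a (?ev p)" using ev that by simp
  qed (use that t in auto)
  have rel_op: "?rel (interp ?F f xs) (interp B f (map \<psi> xs))"
    if f: "\<sigma> f = Some (length xs)" and xs: "\<And>x. x \<in> set xs \<Longrightarrow> ?rel x (\<psi> x)" for f xs \<psi>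
  proof (intro conjI allI impI)
    have B_args: "(f, map \<psi> xs) \<in> args \<sigma> B" using f xs by (auto simp: args_iff)
    then show "interp B f (map \<psi> xs) \<in> univ B" by (rule algebra_closed[OF B])
    fix p assume p: "homom \<sigma> B A p"
    have "map p (map \<psi> xs) = map (\<lambda>x. x (?ev p)) xs" using xs p by auto
    then show "p (interp B f (map \<psi> xs)) = interp ?F f xs (?ev p)"
      using homom_interp[OF p B_args] ev[OF p]
      by (simp add: free_alg_def product_alg_def del: map_map map_eq_conv)
  qed
  have "\<exists>b. ?rel x b" if "x \<in> free_univ \<sigma> A" for x
    using that
  proof induction
    case (gen a)
    then show ?case using rel_gen by blast
  next
    case (op f xs)
    then have "\<forall>x\<in>set xs. \<exists>b. ?rel x b" by blast
    then obtain \<psi> where "\<forall>x\<in>set xs. ?rel x (\<psi> x)" by (rule bchoice[THEN exE])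
    then have "?rel (interp ?F f xs) (interp B f (map \<psi> xs))" using op by (intro rel_op) blast+
    moreover have "interp ?F f xs = interp (product_alg (self_maps A) (\<lambda>_. A)) f xs"
      by (simp add: free_alg_def)
    ultimately show ?case by (intro exI) (simp only:)
  qed
  then have "\<forall>x\<in>univ ?F. \<exists>b. ?rel x b" by (simp add: free_alg_def)
  then obtain \<Psi> where \<Psi>: "\<forall>x\<in>univ ?F. ?rel x (\<Psi> x)" by (rule bchoice[THEN exE])
  have F: "algebra \<sigma> ?F" using subalgebra_free_alg[OF A] by (simp add: subalgebra_def)
  show ?thesis
  proof
    show "homom \<sigma> ?F B \<Psi>"
    proof (rule homomI)
      fix f xs assume xs: "(f, xs) \<in> args \<sigma> ?F"
      have "?rel (interp ?F f xs) (\<Psi> (interp ?F f xs))"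
        using \<Psi> algebra_closed[OF F xs] by blast
      moreover have "?rel (interp ?F f xs) (interp B f (map \<Psi> xs))"
        using xs \<Psi> by (intro rel_op) (auto simp: args_iff)
      ultimately show "\<Psi> (interp ?F f xs) = interp B f (map \<Psi> xs)"
        by (rule rel_unique)
    qed (use \<Psi> in blast)
    fix a assume a: "a \<in> univ A"
    then have "free_gen A a \<in> univ ?F" by (simp add: free_alg_def free_univ.gen)
    with \<Psi> have "?rel (free_gen A a) (\<Psi> (free_gen A a))" by (rule bspec)
    then show "\<Psi> (free_gen A a) = t a"
      using rel_gen[OF a] by (rule rel_unique)
  qed
qed


section \<open>Subdirect irreducibility\<close>

lemma quotient_by_kernel:
  assumes A: "algebra \<sigma> A" and q: "homom \<sigma> A B q"
    and \<theta>: "\<theta> = {(x, y). x \<in> univ A \<and> y \<in> univ A \<and> q x = q y}"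
  shows "algebra \<sigma> (quotient_alg A \<theta>)" and "surj_homom \<sigma> A (quotient_alg A \<theta>) (\<lambda>a. \<theta> `` {a})"
proof -
  let ?r = "\<lambda>c. SOME x. x \<in> c"
  have r: "?r c \<in> univ A" if "c \<in> univ A // \<theta>" for c
  proof -
    from that obtain a where "a \<in> c" by (auto simp: quotient_def \<theta>)
    then have "?r c \<in> c" by (rule someI)
    then show ?thesis using that by (auto simp: quotient_def \<theta>)
  qed
  have q_r: "q (?r (\<theta> `` {a})) = q a" if "a \<in> univ A" for a
  proof -
    have "a \<in> \<theta> `` {a}" using that by (auto simp: \<theta>)
    then have "?r (\<theta> `` {a}) \<in> \<theta> `` {a}" by (rule someI)
    then show ?thesis by (auto simp: \<theta>)
  qed
  have "interp A f (map ?r cs) \<in> univ A" if "(f, cs) \<in> args \<sigma> (quotient_alg A \<theta>)" for f cs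
    using that r by (intro algebra_closed[OF A]) (auto simp: args_iff quotient_alg_def)
  then show Q: "algebra \<sigma> (quotient_alg A \<theta>)"
    using A by (auto simp: algebra_def quotient_alg_def intro!: quotientI)
  have "homom \<sigma> A (quotient_alg A \<theta>) (\<lambda>a. \<theta> `` {a})"
  proof (rule homomI)
    fix f xs assume xs: "(f, xs) \<in> args \<sigma> A"
    let ?ys = "map ?r (map (\<lambda>a. \<theta> `` {a}) xs)"
    have ys: "(f, ?ys) \<in> args \<sigma> A"
      using xs by (auto simp: args_iff simp del: Image_singleton_iff intro!: r quotientI)
    have "map q ?ys = map q xs" using xs q_r by (auto simp: args_iff simp del: Image_singleton_iff)
    then have "q (interp A f ?ys) = q (interp A f xs)"
      using homom_interp[OF q xs] homom_interp[OF q ys] by (simp only:)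
    then have "\<theta> `` {interp A f xs} = \<theta> `` {interp A f ?ys}"
      using algebra_closed[OF A] xs ys by (auto simp: \<theta>)
    then show "\<theta> `` {interp A f xs} = interp (quotient_alg A \<theta>) f (map (\<lambda>a. \<theta> `` {a}) xs)"
      by (simp add: quotient_alg_def)
  qed (auto simp: quotient_alg_def intro: quotientI)
  moreover have "(\<lambda>a. \<theta> `` {a}) ` univ A = univ (quotient_alg A \<theta>)"
    by (auto simp: quotient_alg_def quotient_def)
  ultimately show "surj_homom \<sigma> A (quotient_alg A \<theta>) (\<lambda>a. \<theta> `` {a})"
    by (simp add: surj_homom_def)
qed

text \<open>The quotients of \<open>A\<close> by the kernels of the family form a subdirect representation of
  \<open>A\<close>. Homomorphisms with equal kernels give the same factor, so the kernels themselves serve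
  as indices.\<close>

lemma subdirectly_irreducible_injective:
  assumes A: "algebra \<sigma> A" and si: "subdirectly_irreducible \<sigma> A"
    and H: "H \<noteq> {}" and q: "\<And>h. h \<in> H \<Longrightarrow> homom \<sigma> A B (q h)"
    and joint: "\<And>a b. a \<in> univ A \<Longrightarrow> b \<in> univ A \<Longrightarrow> (\<And>h. h \<in> H \<Longrightarrow> q h a = q h b) \<Longrightarrow> a = b"
  shows "\<exists>h\<in>H. inj_on (q h) (univ A)"
proof -
  define ker where "ker h = {(x, y). x \<in> univ A \<and> y \<in> univ A \<and> q h x = q h y}" for h
  define e where "e a = (\<lambda>\<theta>\<in>ker ` H. \<theta> `` {a})" for a
  have \<theta>: "algebra \<sigma> (quotient_alg A \<theta>)" "surj_homom \<sigma> A (quotient_alg A \<theta>) (\<lambda>a. \<theta> `` {a})"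
    if \<theta>: "\<theta> \<in> ker ` H" for \<theta>
  proof -
    obtain h where h: "h \<in> H" "\<theta> = ker h" using \<theta> by blast
    from quotient_by_kernel[OF A q[OF h(1)] h(2)[unfolded ker_def]]
    show "algebra \<sigma> (quotient_alg A \<theta>)" "surj_homom \<sigma> A (quotient_alg A \<theta>) (\<lambda>a. \<theta> `` {a})" .
  qed
  have ker_class: "q h a = q h b" if "ker h `` {a} = ker h `` {b}" "b \<in> univ A" for h a b
    using that by (auto simp: ker_def)
  have "homom \<sigma> A (product_alg (ker ` H) (quotient_alg A)) e"
    unfolding e_def using \<theta>(2) by (intro homom_into_product) (auto simp: surj_homom_def)
  moreover have "inj_on e (univ A)"
  proof (rule inj_onI)
    fix a b assume a: "a \<in> univ A" and b: "b \<in> univ A" and eq: "e a = e b"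
    have "ker h `` {a} = ker h `` {b}" if "h \<in> H" for h
      using fun_cong[OF eq, of "ker h"] that by (simp add: e_def)
    then show "a = b" using ker_class[OF _ b] joint[OF a b] by blast
  qed
  moreover have "(\<lambda>a. e a \<theta>) ` univ A = univ (quotient_alg A \<theta>)" if "\<theta> \<in> ker ` H" for \<theta>
    using \<theta>(2)[OF that] that by (simp add: e_def surj_homom_def)
  ultimately have "subdirect_embedding \<sigma> A (ker ` H) (quotient_alg A) e"
    using \<theta>(1) by (auto simp: subdirect_embedding_def embedding_def)
  then obtain \<theta> where \<theta>: "\<theta> \<in> ker ` H" "isom \<sigma> A (quotient_alg A \<theta>) (\<lambda>a. e a \<theta>)"
    using si H unfolding subdirectly_irreducible_def by (metis image_is_empty)
  then obtain h where h: "h \<in> H" "\<theta> = ker h" by blast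
  have "inj_on (q h) (univ A)"
  proof (rule inj_onI)
    fix a b assume ab: "a \<in> univ A" "b \<in> univ A" "q h a = q h b"
    then have "e a \<theta> = e b \<theta>" using \<theta>(1) by (auto simp: e_def h(2) ker_def)
    then show "a = b" using \<theta>(2) ab by (auto simp: isom_def bij_betw_def dest: inj_onD)
  qed
  then show ?thesis using h(1) by blast
qed


section \<open>Weak projectivity and projectivity\<close>

text \<open>The free algebra is finite, so it has a copy over every infinite type; weak
  projectivity is applied to that copy.\<close>

lemma weakly_projective_embeds_in_free_alg:
  fixes A :: "('f, 'a) alg"
  assumes A: "algebra \<sigma> A" and fin: "finite (univ A)" and inf: "infinite (UNIV :: 'u set)"
    and wp: "weakly_projective_in \<sigma> A (quasivariety \<sigma> A :: ('f, 'u) alg set)"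
  obtains g where "embedding \<sigma> A (free_alg \<sigma> A) g"
proof -
  let ?F = "free_alg \<sigma> A"
  have F: "algebra \<sigma> ?F" using subalgebra_free_alg[OF A] by (simp add: subalgebra_def)
  obtain V :: "'u set" where "finite V" "card V = card (univ ?F)"
    using infinite_arbitrarily_large[OF inf] by metis
  then obtain k where "bij_betw k (univ ?F) V"
    using finite_same_card_bij[OF finite_free_alg[OF A fin]] by metis
  then have "inj_on k (univ ?F)" by (rule bij_betw_imp_inj_on)
  then obtain F' :: "('f, 'u) alg" where F': "algebra \<sigma> F'" and k: "isom \<sigma> ?F F' k"
    using algebra_copy[OF F] by metis
  define j where "j = inv_into (univ ?F) k"
  have j: "isom \<sigma> F' ?F j" unfolding j_def by (rule isom_inverse[OF F k])
  then have j_hom: "homom \<sigma> F' ?F j" and j_emb: "embedding \<sigma> F' ?F j"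
    and j_im: "j ` univ F' = univ ?F"
    by (auto simp: isom_def embedding_def bij_betw_def)
  have "separated_by \<sigma> A ?F"
    unfolding separated_by_def
    using free_alg_eqI[OF A] homom_free_coordinate[OF A] by (metis (no_types, lifting))
  then have "F' \<in> quasivariety \<sigma> A"
    by (intro quasivariety_if_separated[OF A F'] separated_by_embedding[OF j_emb])
  moreover have "hom_image \<sigma> A F'"
  proof -
    \<comment> \<open>The coordinate at the identity map sends the generator of \<open>a\<close> to \<open>a\<close>.\<close>
    let ?id = "\<lambda>a\<in>univ A. a"
    have id: "?id \<in> self_maps A" by simp
    have hom: "homom \<sigma> F' A (\<lambda>x. j x ?id)"
      by (rule homom_comp[OF j_hom homom_free_coordinate[OF A id]])
    have "a \<in> (\<lambda>x. j x ?id) ` univ F'" if a: "a \<in> univ A" for a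
    proof -
      have "free_gen A a \<in> j ` univ F'"
        unfolding j_im using a by (simp add: free_alg_def free_univ.gen)
      then obtain x where "x \<in> univ F'" "j x = free_gen A a" by auto
      then show ?thesis using a id by (intro image_eqI[of _ _ x]) auto
    qed
    then have "surj_homom \<sigma> F' A (\<lambda>x. j x ?id)"
      using hom homom_in[OF hom] by (auto simp: surj_homom_def)
    then show ?thesis by (auto simp: hom_image_def)
  qed
  ultimately obtain C g where C: "subalgebra \<sigma> C F'" and g: "isom \<sigma> A C g"
    using wp by (auto simp: weakly_projective_in_def isomorphic_def)
  have "homom \<sigma> A ?F (\<lambda>a. j (g a))"
    using homom_comp[OF homom_comp[OF _ homom_subalgebra[OF C]] j_hom] g by (auto simp: isom_def)
  moreover have "inj_on (\<lambda>a. j (g a)) (univ A)"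
  proof -
    have "g ` univ A \<subseteq> univ F'" and g_inj: "inj_on g (univ A)"
      using g C by (auto simp: isom_def bij_betw_def subalgebra_def)
    moreover have "inj_on j (univ F')"
      using j_emb by (simp add: embedding_def)
    ultimately have "inj_on j (g ` univ A)" by (simp add: inj_on_subset)
    from comp_inj_on[OF g_inj this] show ?thesis by (simp add: comp_def)
  qed
  ultimately show ?thesis by (intro that) (simp add: embedding_def)
qed

lemma finite_injective_endomorphism_isom:
  assumes "finite (univ A)" and "homom \<sigma> A A q" and "inj_on q (univ A)"
  shows "isom \<sigma> A A q"
  using assms endo_inj_surj[of "univ A" q] homom_in[OF assms(2)]
  by (auto simp: isom_def bij_betw_def)

text \<open>Some coordinate is injective on the image of \<open>e\<close>, by subdirect irreducibility, so its
  composite with \<open>e\<close> is an automorphism of the finite algebra \<open>A\<close>. The section is \<open>e\<close> after the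
  inverse of this automorphism.\<close>

lemma free_coordinate_splits:
  assumes A: "algebra \<sigma> A" and fin: "finite (univ A)" and si: "subdirectly_irreducible \<sigma> A"
    and e: "embedding \<sigma> A (free_alg \<sigma> A) e"
  obtains h g where "h \<in> self_maps A" and "homom \<sigma> A (free_alg \<sigma> A) g"
    and "\<And>a. a \<in> univ A \<Longrightarrow> g a h = a"
proof -
  have e_hom: "homom \<sigma> A (free_alg \<sigma> A) e" and e_inj: "inj_on e (univ A)"
    using e by (auto simp: embedding_def)
  have q: "homom \<sigma> A A (\<lambda>a. e a h)" if "h \<in> self_maps A" for h
    by (rule homom_comp[OF e_hom homom_free_coordinate[OF A that]])
  have "\<exists>h\<in>self_maps A. inj_on (\<lambda>a. e a h) (univ A)"
  proof (rule subdirectly_irreducible_injective[OF A si _ q])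
    have "(\<lambda>a\<in>univ A. a) \<in> self_maps A" by simp
    then show "self_maps A \<noteq> {}" by blast
    fix a b assume "a \<in> univ A" "b \<in> univ A" "\<And>h. h \<in> self_maps A \<Longrightarrow> e a h = e b h"
    then show "a = b"
      using free_alg_eqI[OF A, of "e a" "e b"] homom_in[OF e_hom] inj_onD[OF e_inj] by blast
  qed
  then obtain h where h: "h \<in> self_maps A" and inj: "inj_on (\<lambda>a. e a h) (univ A)" by blast
  have aut: "isom \<sigma> A A (\<lambda>a. e a h)"
    by (rule finite_injective_endomorphism_isom[OF fin q[OF h] inj])
  define r where "r = inv_into (univ A) (\<lambda>a. e a h)"
  have "homom \<sigma> A A r"
    using isom_inverse[OF A aut] by (simp add: r_def isom_def)
  then have "homom \<sigma> A (free_alg \<sigma> A) (\<lambda>a. e (r a))"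
    by (rule homom_comp[OF _ e_hom])
  moreover have "e (r a) h = a" if "a \<in> univ A" for a
    using that aut f_inv_into_f[of a "\<lambda>a. e a h" "univ A"] by (simp add: r_def isom_def bij_betw_def)
  ultimately show ?thesis by (rule that[OF h])
qed

theorem theorem3p15:
  fixes \<sigma> :: "'f simtype" and A :: "('f, 'a) alg"
  assumes "algebra \<sigma> A"
    and "finite (univ A)"
    and "subdirectly_irreducible \<sigma> A"
    and "infinite (UNIV :: 'u set)"
    and "weakly_projective_in \<sigma> A (quasivariety \<sigma> A :: ('f, 'u) alg set)"
  shows "projective_in \<sigma> A (quasivariety \<sigma> A :: ('f, 'u) alg set)"
  unfolding projective_in_def
proof (intro ballI allI impI)
  fix B :: "('f, 'u) alg" and f
  assume BQ: "B \<in> quasivariety \<sigma> A" and f: "surj_homom \<sigma> B A f"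
  note A = assms(1)
  have B: "algebra \<sigma> B" and sep: "separated_by \<sigma> A B"
    using BQ quasivariety_iff_separated[OF A assms(2), of B] by simp_all
  obtain e where "embedding \<sigma> A (free_alg \<sigma> A) e"
    by (rule weakly_projective_embeds_in_free_alg[OF A assms(2,4,5)])
  then obtain h g where h: "h \<in> self_maps A" and g: "homom \<sigma> A (free_alg \<sigma> A) g"
    and gh: "\<And>a. a \<in> univ A \<Longrightarrow> g a h = a"
    by (rule free_coordinate_splits[OF A assms(2,3)]) blast
  have f_hom: "homom \<sigma> B A f" and f_im: "f ` univ B = univ A"
    using f by (auto simp: surj_homom_def)
  define s where "s = inv_into (univ B) f"
  have s: "s a \<in> univ B" "f (s a) = a" if "a \<in> univ A" for a
    using that f_im by (auto simp: s_def inv_into_into f_inv_into_f)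
  have "(\<lambda>a. s (h a)) \<in> univ A \<rightarrow> univ B"
    using s(1) PiE_mem[OF h] by blast
  then obtain \<Psi> where \<Psi>: "homom \<sigma> (free_alg \<sigma> A) B \<Psi>"
    and \<Psi>_gen: "\<And>a. a \<in> univ A \<Longrightarrow> \<Psi> (free_gen A a) = s (h a)"
    by (rule free_alg_extension[OF A B sep]) blast
  have f\<Psi>: "f (\<Psi> x) = x h" if "x \<in> univ (free_alg \<sigma> A)" for x
  proof (rule homom_eq_on_free_alg[OF homom_comp[OF \<Psi> f_hom] homom_free_coordinate[OF A h] _ that])
    fix a assume a: "a \<in> univ A"
    then have "h a \<in> univ A" using PiE_mem[OF h] by blast
    then show "f (\<Psi> (free_gen A a)) = free_gen A a h"
      using \<Psi>_gen[OF a] s h by simp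
  qed
  have sec: "f (\<Psi> (g a)) = a" if "a \<in> univ A" for a
    using f\<Psi>[OF homom_in[OF g that]] gh[OF that] by simp
  then have "inj_on (\<lambda>a. \<Psi> (g a)) (univ A)"
    by (rule inj_on_inverseI)
  then show "\<exists>g. embedding \<sigma> A B g \<and> (\<forall>a\<in>univ A. f (g a) = a)"
    using homom_comp[OF g \<Psi>] sec by (intro exI[of _ "\<lambda>a. \<Psi> (g a)"]) (simp add: embedding_def)
qed

end
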